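(* Assume the following hypothesis holds: for every rational number $0<\theta\le 1$ there exists an integer $n_0=n_0(\theta)$ such that for all $n\ge n_0+1$, \[ R_n(\theta)=R_{n_0}(\theta)+R_{n-n_0}\bigl(\theta-R_{n_0}(\theta)\bigr), \] and the best $(n-n_0)$-term Egyptian underapproximation of $\theta-R_{n_0}(\theta)$ is always the one constructed by the greedy algorithm. Let $0<\lambda\le 1$ be a rational number whose best $m$-term Egyptian underapproximation is unique for every positive integer $m$. Let $\{u_n\}_{n=1}^\infty$ be the best Egyptian underapproximation of $\lambda$, and let $a_1<a_2<\cdots$ be any other sequence of positive integers satisfying $\sum_{i=1}^\infty \frac{1}{a_i}=\lambda$. Then there exists an eventually Sylvester sequence $\{c_n\}_{n=1}^\infty$ of positive integers satisfying $\sum_{i=1}^\infty \frac{1}{c_i}=\lambda$, such that $\{c_n\}$ and $\{u_n\}$ are distinct as sets, and \[ \liminf_{n\to\infty} a_n^{1/2^n} \le \lim_{n\to\infty} c_n^{1/2^n}. \]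
   Context: An $n$-term Egyptian underapproximation of a rational $0<\lambda\le1$ is a sequence of positive integers $x_1\le\cdots\le x_n$ with $\sum_{i=1}^n 1/x_i<\lambda$; the best one maximizes this sum and $R_n(\lambda)$ denotes the maximal sum. The greedy one is defined by $x_i=\lfloor(\lambda-\sum_{j<i}1/x_j)^{-1}\rfloor+1$. When the best $m$-term underapproximation is unique for all $m$, the best Egyptian underapproximation $\{u_n\}$ is the infinite sequence whose first $m$ terms form the best $m$-term underapproximation for each $m$. A sequence $\{c_n\}$ of positive integers is eventually Sylvester if there is $N>0$ with $c_{n+1}=c_n^2-c_n+1$ for all $n\ge N$. *)

theory Defs
  imports Complex_Main "HOL-Library.Extended_Real" "HOL-Library.Liminf_Limsup"
begin

definition recip_sum :: "nat list \<Rightarrow> real" where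
  "recip_sum xs = (\<Sum>x\<leftarrow>xs. 1 / real x)"

definition egyptian_under :: "real \<Rightarrow> nat \<Rightarrow> nat list \<Rightarrow> bool" where
  "egyptian_under \<theta> n xs \<longleftrightarrow>
     length xs = n \<and> sorted xs \<and> (\<forall>x\<in>set xs. 0 < x) \<and> recip_sum xs < \<theta>"

(* A maximiser, not necessarily the only one. *)
definition best_under :: "real \<Rightarrow> nat \<Rightarrow> nat list \<Rightarrow> bool" where
  "best_under \<theta> n xs \<longleftrightarrow>
     egyptian_under \<theta> n xs \<and> (\<forall>ys. egyptian_under \<theta> n ys \<longrightarrow> recip_sum ys \<le> recip_sum xs)"

(* For n = 0 and positive theta only the empty list competes, so R 0 theta = 0. *)
definition R :: "nat \<Rightarrow> real \<Rightarrow> real" where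
  "R n \<theta> = (GREATEST r. \<exists>xs. egyptian_under \<theta> n xs \<and> r = recip_sum xs)"

primrec greedy_under :: "real \<Rightarrow> nat \<Rightarrow> nat list" where
  "greedy_under \<theta> 0 = []"
| "greedy_under \<theta> (Suc n) =
     greedy_under \<theta> n @ [nat (\<lfloor>inverse (\<theta> - recip_sum (greedy_under \<theta> n))\<rfloor> + 1)]"

(* The greedy list is required to attain the maximum; that it is the only list to do so
   is not assumed. *)
definition eventually_greedy_best :: "real \<Rightarrow> bool" where
  "eventually_greedy_best \<theta> \<longleftrightarrow>
     (\<exists>n0::nat. \<forall>n\<ge>n0 + 1.
        R n \<theta> = R n0 \<theta> + R (n - n0) (\<theta> - R n0 \<theta>) \<and>
        best_under (\<theta> - R n0 \<theta>) (n - n0) (greedy_under (\<theta> - R n0 \<theta>) (n - n0)))"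

(* Infinite sequences are functions on nat used at the indices n >= 1 only;
   the value at 0 is irrelevant. *)

definition best_seq :: "real \<Rightarrow> (nat \<Rightarrow> nat) \<Rightarrow> bool" where
  "best_seq \<theta> u \<longleftrightarrow> (\<forall>m\<ge>1. best_under \<theta> m (map u [1..<m + 1]))"

definition eventually_sylvester :: "(nat \<Rightarrow> nat) \<Rightarrow> bool" where
  "eventually_sylvester c \<longleftrightarrow> (\<exists>N>0. \<forall>n\<ge>N. c (n + 1) = (c n)\<^sup>2 - c n + 1)"

end

theory Submission
  imports Defs "HOL-Library.Multiset"
begin

text \<open>If every \<open>a\<^sub>m\<close> is a term of \<open>u\<close>, then \<open>a\<close> is \<open>u\<close>: the sequence \<open>u\<close> is strictly
  increasing, since a repeated term \<open>k, k\<close> could be replaced by \<open>k/2\<close> and a huge denominator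
  (\<open>k\<close> even), or by \<open>(k+1)/2, k(k+1)/2\<close> (\<open>k\<close> odd), against maximality or uniqueness.
  Otherwise fix a term \<open>a\<^sub>m\<close> missing from \<open>u\<close> and let \<open>c\<close> be \<open>a\<^sub>1, \<dots>, a\<^sub>m\<close> followed by best
  underapproximations of the remainder, which by the hypothesis end in a greedy expansion. A greedy
  expansion of a rational is eventually Sylvester because the numerators of the remainders do not
  increase. The partial sums of \<open>c\<close> eventually dominate those of \<open>a\<close>, so the tails satisfy
  \<open>1/(c\<^sub>n - 1) \<le> \<Sum>i\<ge>n. 1/a\<^sub>i\<close>, whereas \<open>a\<^sub>i \<ge> M^(2^i)\<close> for all large \<open>i\<close> would bound the latter
  by \<open>1/(M^(2^n) - 1)\<close>.\<close>

section \<open>Elementary facts on sums of unit fractions\<close>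

lemma recip_sum_simps [simp]:
  "recip_sum [] = 0"
  "recip_sum (x # xs) = 1 / real x + recip_sum xs"
  "recip_sum (xs @ ys) = recip_sum xs + recip_sum ys"
  by (simp_all add: recip_sum_def)

lemma recip_sum_mset_cong: "mset xs = mset ys \<Longrightarrow> recip_sum xs = recip_sum ys"
  unfolding recip_sum_def by (metis mset_map sum_mset_sum_list)

lemma recip_sum_nonneg: "0 \<le> recip_sum xs"
  by (induction xs) auto

lemma recip_sum_Rats: "recip_sum xs \<in> \<rat>"
  by (induction xs) auto

lemma recip_sum_map: "recip_sum (map f [1..<Suc n]) = (\<Sum>i<n. 1 / real (f (i + 1)))"
  by (induction n) auto

lemma sum_lessThan_add:
  fixes f :: "nat \<Rightarrow> 'a::comm_monoid_add"
  shows "(\<Sum>i<m + n. f i) = (\<Sum>i<m. f i) + (\<Sum>i<n. f (m + i))"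
  by (induction n) (simp_all add: add.assoc)

lemma recip_sum_le:
  assumes "\<forall>x\<in>set xs. N \<le> x" "0 < N"
  shows "recip_sum xs \<le> length xs / real N"
  using assms(1)
proof (induction xs)
  case (Cons x xs)
  have "1 / real x \<le> 1 / real N"
    using Cons.prems assms(2) by (intro divide_left_mono) auto
  with Cons show ?case
    by (simp add: add_divide_distrib)
qed simp

section \<open>Existence of best underapproximations\<close>

lemma egyptian_under_sort:
  assumes "length xs = n" "\<forall>x\<in>set xs. 0 < x" "recip_sum xs < \<theta>"
  shows "egyptian_under \<theta> n (sort xs)" "recip_sum (sort xs) = recip_sum xs"
proof -
  show "recip_sum (sort xs) = recip_sum xs"
    by (rule recip_sum_mset_cong) simp
  with assms show "egyptian_under \<theta> n (sort xs)"
    by (simp add: egyptian_under_def)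
qed

text \<open>Sorting preserves the sum and the entries, so a best list can be tested against
  competitors given in any order.\<close>

lemma best_under_ge:
  assumes "best_under \<theta> n xs" "length ys = n" "\<forall>x\<in>set ys. 0 < x" "recip_sum ys < \<theta>"
  shows "recip_sum ys \<le> recip_sum xs"
  using assms egyptian_under_sort[of ys n \<theta>] by (metis best_under_def)

lemma egyptian_under_exists:
  assumes "0 < \<theta>"
  shows "\<exists>xs. egyptian_under \<theta> n xs"
proof -
  obtain N :: nat where N: "n / \<theta> < real N"
    using reals_Archimedean2 by blast
  have "0 \<le> n / \<theta>"
    using assms by simp
  hence "0 < real N"
    using N by linarith
  hence "0 < N"
    by simp
  have "recip_sum (replicate n N) \<le> n / real N"
    using recip_sum_le[of "replicate n N" N] \<open>0 < N\<close> by simp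
  also have "\<dots> < \<theta>"
    using N assms \<open>0 < N\<close> by (simp add: field_simps)
  finally show ?thesis
    using egyptian_under_sort[of "replicate n N" n \<theta>] \<open>0 < N\<close> by auto
qed

text \<open>Infinitely many lists compete, so the maximum must come from a finite choice. In the
  induction step let \<open>B\<close> be the sum of some admissible list. A list with sum at least
  \<open>B\<close> has least entry at most \<open>Suc n / B\<close>. Finitely many first entries
  remain, and the induction hypothesis supplies a best tail for each.\<close>

lemma best_under_exists:
  assumes "0 < \<theta>"
  shows "\<exists>xs. best_under \<theta> n xs"
  using assms
proof (induction n arbitrary: \<theta>)
  case 0
  show ?case
    by (rule exI[of _ "[]"]) (use 0 in \<open>auto simp: best_under_def egyptian_under_def\<close>)
next
  case (Suc n)
  obtain zs where zs: "egyptian_under \<theta> (Suc n) zs"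
    using egyptian_under_exists[OF Suc.prems] by blast
  then obtain z zs' where z: "zs = z # zs'" "0 < z"
    by (cases zs) (auto simp: egyptian_under_def)
  define B where "B = recip_sum zs"
  have "0 < B"
    using z recip_sum_nonneg[of zs'] by (simp add: B_def add_pos_nonneg)
  \<comment> \<open>The condition \<open>1 / real x < \<theta>\<close> keeps the target of the tail
    positive, as the induction hypothesis requires.\<close>
  define I where "I = {x::nat. 0 < x \<and> 1 / real x < \<theta> \<and> real x \<le> Suc n / B}"
  have "finite I"
  proof (rule finite_subset)
    show "I \<subseteq> {..nat \<lfloor>Suc n / B\<rfloor>}"
      by (auto simp: I_def le_nat_floor)
  qed simp
  define T where "T x = (SOME ys. best_under (\<theta> - 1 / real x) n ys)" for x
  have T: "best_under (\<theta> - 1 / real x) n (T x)" if "x \<in> I" for x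
    unfolding T_def by (rule someI_ex, rule Suc.IH) (use that in \<open>simp add: I_def\<close>)
  have dominated: "\<exists>x\<in>I. recip_sum ys \<le> recip_sum (x # T x)"
    if ys: "egyptian_under \<theta> (Suc n) ys" "B \<le> recip_sum ys" for ys
  proof -
    obtain x ys' where x: "ys = x # ys'"
      using ys by (cases ys) (auto simp: egyptian_under_def)
    have x': "0 < x" "\<forall>y\<in>set ys. x \<le> y" "length ys' = n" "\<forall>y\<in>set ys'. 0 < y"
      "recip_sum ys < \<theta>"
      using ys x by (auto simp: egyptian_under_def)
    have "B \<le> Suc n / real x"
      using recip_sum_le[OF x'(2,1)] ys x x' by simp
    hence "real x \<le> Suc n / B"
      using x'(1) \<open>0 < B\<close> by (simp add: field_simps)
    moreover have "1 / real x < \<theta>"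
      using x'(5) x recip_sum_nonneg[of ys'] by simp
    ultimately have "x \<in> I"
      using x'(1) by (simp add: I_def)
    moreover have "recip_sum ys' \<le> recip_sum (T x)"
      using best_under_ge[OF T[OF \<open>x \<in> I\<close>] x'(3,4)] x'(5) x by simp
    ultimately show ?thesis
      using x by (intro bexI[of _ x]) auto
  qed
  have "I \<noteq> {}"
    using dominated[OF zs] by (auto simp: B_def)
  define s where "s = Max ((\<lambda>x. recip_sum (x # T x)) ` I)"
  have "s \<in> (\<lambda>x. recip_sum (x # T x)) ` I"
    unfolding s_def using \<open>finite I\<close> \<open>I \<noteq> {}\<close> by (intro Max_in) auto
  then obtain x where x: "x \<in> I" "s = recip_sum (x # T x)"
    by blast
  have s: "recip_sum ys \<le> s" if "egyptian_under \<theta> (Suc n) ys" for ys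
  proof -
    have le: "recip_sum (x # T x) \<le> s" if "x \<in> I" for x
      unfolding s_def by (rule Max_ge) (use \<open>finite I\<close> that in auto)
    have "B \<le> s"
      using dominated[OF zs] le by (force simp: B_def)
    show ?thesis
    proof (cases "B \<le> recip_sum ys")
      case True
      then show ?thesis
        using dominated[OF that] le by force
    next
      case False
      then show ?thesis
        using \<open>B \<le> s\<close> by linarith
    qed
  qed
  \<comment> \<open>\<open>x # T x\<close> need not be sorted, because the tail may contain entries
    below \<open>x\<close>; sorting repairs this without changing the sum.\<close>
  have "length (x # T x) = Suc n" "\<forall>y\<in>set (x # T x). 0 < y" "recip_sum (x # T x) < \<theta>"
    using T[OF x(1)] x(1) by (auto simp: best_under_def egyptian_under_def I_def)
  from egyptian_under_sort[OF this] s x show ?case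
    unfolding best_under_def by auto
qed

lemma R_eq:
  assumes "best_under \<theta> n xs"
  shows "R n \<theta> = recip_sum xs"
  unfolding R_def using assms by (intro Greatest_equality) (auto simp: best_under_def)

section \<open>Strict monotonicity of the best sequence\<close>

lemma best_seq_pos:
  assumes "best_seq \<theta> u" "1 \<le> n"
  shows "0 < u n"
proof -
  have "\<forall>x\<in>set (map u [1..<n + 1]). 0 < x"
    using assms unfolding best_seq_def best_under_def egyptian_under_def by blast
  thus ?thesis
    using assms by auto
qed

lemma best_seq_strict_mono_on:
  assumes "\<theta> \<le> 1" "\<forall>m\<ge>1. \<exists>!xs. best_under \<theta> m xs" "best_seq \<theta> u"
  shows "strict_mono_on {1..} u"
proof -
  have step: "u j < u (Suc j)" if "1 \<le> j" for j
  proof (rule ccontr)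
    assume not_less: "\<not> u j < u (Suc j)"
    define P where "P = map u [1..<j]"
    have "map u [1..<Suc j + 1] = P @ [u j, u (Suc j)]"
      using that by (simp add: P_def)
    then have best: "best_under \<theta> (Suc j) (P @ [u j, u (Suc j)])"
      using assms(3) unfolding best_seq_def by (metis le_add1 plus_1_eq_Suc)
    define k where "k = u j"
    \<comment> \<open>Sortedness of the best list gives \<open>u j \<le> u (Suc j)\<close>, so a
      failure of strictness means equality.\<close>
    have "u (Suc j) = k"
      using best not_less by (auto simp: best_under_def egyptian_under_def sorted_append k_def)
    with best have best: "best_under \<theta> (Suc j) (P @ [k, k])"
      by (simp add: k_def)
    have P: "\<forall>x\<in>set P. 0 < x" "length P = j - 1" "0 < k" "recip_sum P + 2 / real k < \<theta>"
      using best that by (auto simp: best_under_def egyptian_under_def P_def)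
    show False
    proof (cases "even k")
      case True
      then obtain l where l: "k = 2 * l"
        by (elim evenE)
      \<comment> \<open>Since \<open>2 / k = 1 / l\<close>, the entry \<open>l\<close> alone
        replaces the pair. The slack \<open>d\<close> then has room for one more unit fraction,
        giving a larger sum at the same length.\<close>
      define d where "d = \<theta> - (recip_sum P + 1 / real l)"
      have "0 < d"
        using P l by (simp add: d_def)
      then obtain y :: nat where y: "0 < y" "1 / real y < d"
        using reals_Archimedean[of d] by (metis inverse_eq_divide zero_less_Suc)
      have "recip_sum (P @ [l, y]) \<le> recip_sum (P @ [k, k])"
        by (rule best_under_ge[OF best]) (use P l y that in \<open>auto simp: d_def\<close>)
      thus False
        using l y by simp
    next
      case False
      then obtain l0 where l0: "k = 2 * l0 + 1"
        by (elim oddE)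
      define l where "l = l0 + 1"
      have kl: "k + 1 = 2 * l" "0 < l"
        using l0 by (auto simp: l_def)
      \<comment> \<open>For \<open>k = 1\<close> the replacement pair would again be
        \<open>1, 1\<close>. This case is excluded by \<open>\<theta> \<le> 1\<close>, since the
        pair alone sums to 2.\<close>
      have "k \<noteq> 1"
        using P assms(1) recip_sum_nonneg[of P] by auto
      have "real k + 1 = 2 * real l"
        using kl by linarith
      have "1 / real l + 1 / real (k * l) = (real k + 1) / real (k * l)"
        using P kl by (simp add: add_divide_distrib)
      also note \<open>real k + 1 = 2 * real l\<close>
      also have "2 * real l / real (k * l) = 2 / real k"
        using kl by simp
      finally have eq: "1 / real l + 1 / real (k * l) = 2 / real k" .
      have "0 < k * l"
        using P(3) kl(2) by simp
      define zs where "zs = P @ [l, k * l]"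
      have "length zs = Suc j" "\<forall>x\<in>set zs. 0 < x" "recip_sum zs = recip_sum (P @ [k, k])"
        "recip_sum zs < \<theta>"
        using P(1,2,4) \<open>0 < k * l\<close> kl(2) eq that by (auto simp: zs_def)
      \<comment> \<open>The replacement has the same sum, hence is best too, and uniqueness makes
        the two multisets equal. Then \<open>l = k\<close>, which forces
        \<open>k = 1\<close>.\<close>
      hence "best_under \<theta> (Suc j) (sort zs)"
        using egyptian_under_sort[of zs "Suc j" \<theta>] best by (auto simp: best_under_def)
      hence "sort zs = P @ [k, k]"
        using assms(2) best by (metis le_add1 plus_1_eq_Suc)
      hence "mset zs = mset (P @ [k, k])"
        by (metis mset_sort)
      hence eq_mset: "{#k * l, l#} = {#k, k#}"
        by (simp add: zs_def)
      have "l \<in># {#k * l, l#}"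
        by simp
      hence "l = k"
        unfolding eq_mset by simp
      thus False
        using kl(1) \<open>k \<noteq> 1\<close> by linarith
    qed
  qed
  \<comment> \<open>The shift removes the irrelevant value at 0, so that the successor criterion on
    all of \<open>nat\<close> applies.\<close>
  have mono: "strict_mono (\<lambda>n. u (Suc n))"
    by (rule strict_mono_Suc_iff[THEN iffD2]) (use step in auto)
  show ?thesis
  proof (rule strict_mono_onI)
    fix i j :: nat
    assume "i \<in> {1..}" "j \<in> {1..}" "i < j"
    then show "u i < u j"
      using strict_monoD[OF mono, of "i - 1" "j - 1"] by simp
  qed
qed

section \<open>Comparison of a sequence with one containing all its terms\<close>

text \<open>Let \<open>g n\<close> be the position in \<open>u\<close> of the term
  \<open>a n\<close>. Both sequences increase, hence so does \<open>g\<close>; thus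
  \<open>n \<le> g n\<close> and \<open>u n \<le> u (g n) = a n\<close>.\<close>

lemma strict_mono_on_range_subset_le:
  fixes u a :: "nat \<Rightarrow> nat"
  assumes a: "strict_mono_on {1..} a" and u: "strict_mono_on {1..} u"
    and sub: "a ` {1..} \<subseteq> u ` {1..}" and "1 \<le> n"
  shows "u n \<le> a n"
proof -
  define g where "g n = (SOME i. 1 \<le> i \<and> u i = a n)" for n
  have g: "1 \<le> g n \<and> u (g n) = a n" if "1 \<le> n" for n
    unfolding g_def by (rule someI_ex) (use sub that in \<open>force simp: image_subset_iff image_iff\<close>)
  have "n \<le> g n"
    using \<open>1 \<le> n\<close>
  proof (induction n rule: dec_induct)
    case base
    then show ?case using g by simp
  next
    case (step n)
    have "a n < a (Suc n)"
      using step by (intro strict_mono_onD[OF a]) auto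
    hence "g n < g (Suc n)"
      using g[of n] g[of "Suc n"] step strict_mono_on_less[OF u, of "g n" "g (Suc n)"]
      by simp
    with step show ?case by simp
  qed
  hence "u n \<le> u (g n)"
    using \<open>1 \<le> n\<close> g by (intro monotone_onD[OF strict_mono_on_imp_mono_on[OF u]]) auto
  thus ?thesis
    using g \<open>1 \<le> n\<close> by simp
qed

lemma partial_sum_less_of_sums:
  fixes a :: "nat \<Rightarrow> nat"
  assumes "\<forall>n\<ge>1. 0 < a n" "(\<lambda>i. 1 / real (a (i + 1))) sums s"
  shows "(\<Sum>i<n. 1 / real (a (i + 1))) < s"
  using assms sum_less_suminf[of "\<lambda>i. 1 / real (a (i + 1))" n] by (auto simp: sums_iff)

text \<open>Termwise \<open>u \<le> a\<close>, so the differences \<open>f i\<close> of reciprocals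
  are nonnegative. A strict inequality at \<open>n = Suc m\<close> would keep all later partial sums
  of \<open>a\<close> at least \<open>f m\<close> below \<open>s\<close>, whereas they converge to
  \<open>s\<close>.\<close>

lemma seq_eq_of_sums_of_range_subset:
  fixes u a :: "nat \<Rightarrow> nat"
  assumes a: "strict_mono_on {1..} a" and u: "strict_mono_on {1..} u"
    and sub: "a ` {1..} \<subseteq> u ` {1..}"
    and pos: "\<forall>n\<ge>1. 0 < u n"
    and a_sum: "(\<lambda>i. 1 / real (a (i + 1))) sums s"
    and u_sum: "\<And>n. (\<Sum>i<n. 1 / real (u (i + 1))) \<le> s"
    and "1 \<le> n"
  shows "a n = u n"
proof (rule ccontr)
  assume "a n \<noteq> u n"
  note le = strict_mono_on_range_subset_le[OF a u sub]
  obtain m where m: "n = Suc m"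
    using \<open>1 \<le> n\<close> by (cases n) auto
  define f where "f i = 1 / real (u (i + 1)) - 1 / real (a (i + 1))" for i
  have f: "0 \<le> f i" for i
    using frac_le[of 1 1 "real (u (i + 1))" "real (a (i + 1))"] le[of "i + 1"] pos
    by (simp add: f_def)
  have "u n < a n"
    using le[OF \<open>1 \<le> n\<close>] \<open>a n \<noteq> u n\<close> by simp
  hence "0 < f m"
    using frac_less2[of 1 1 "real (u n)" "real (a n)"] pos m by (simp add: f_def)
  have "(\<Sum>i<N. 1 / real (a (i + 1))) \<le> s - f m" if "n \<le> N" for N
  proof -
    have "f m \<le> sum f {..<N}"
      using that m f by (intro member_le_sum) auto
    thus ?thesis
      using u_sum[of N] by (simp add: f_def sum_subtractf)
  qed
  moreover have "(\<lambda>N. \<Sum>i<N. 1 / real (a (i + 1))) \<longlonglongrightarrow> s"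
    using a_sum by (simp add: sums_def)
  ultimately have "s \<le> s - f m"
    by (intro LIMSEQ_le_const2) auto
  thus False
    using \<open>0 < f m\<close> by simp
qed

section \<open>Greedy expansions of positive rationals\<close>

definition greedy_rem :: "real \<Rightarrow> nat \<Rightarrow> real" where
  "greedy_rem \<theta> k = \<theta> - recip_sum (greedy_under \<theta> k)"

text \<open>The entry that \<open>greedy_under\<close> appends after \<open>k\<close> entries; it
  turns the greedy lists into one sequence, indexed from 0.\<close>

definition greedy_term :: "real \<Rightarrow> nat \<Rightarrow> nat" where
  "greedy_term \<theta> k = nat (\<lfloor>inverse (greedy_rem \<theta> k)\<rfloor> + 1)"

lemma greedy_under_Suc: "greedy_under \<theta> (Suc k) = greedy_under \<theta> k @ [greedy_term \<theta> k]"
  by (simp add: greedy_term_def greedy_rem_def)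

lemma recip_sum_greedy_under:
  "recip_sum (greedy_under \<theta> k) = (\<Sum>i<k. 1 / real (greedy_term \<theta> i))"
  by (induction k) (simp_all add: greedy_under_Suc del: greedy_under.simps(2))

lemma greedy_rem_Suc: "greedy_rem \<theta> (Suc k) = greedy_rem \<theta> k - 1 / real (greedy_term \<theta> k)"
  by (simp add: greedy_rem_def greedy_under_Suc del: greedy_under.simps(2))

lemma greedy_term_bounds:
  assumes "0 < greedy_rem \<theta> k"
  shows "inverse (greedy_rem \<theta> k) < real (greedy_term \<theta> k)"
    "real (greedy_term \<theta> k) \<le> inverse (greedy_rem \<theta> k) + 1"
proof -
  have "0 \<le> \<lfloor>inverse (greedy_rem \<theta> k)\<rfloor>"
    using assms by simp
  hence "real (greedy_term \<theta> k) = of_int \<lfloor>inverse (greedy_rem \<theta> k)\<rfloor> + 1"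
    by (simp add: greedy_term_def)
  thus "inverse (greedy_rem \<theta> k) < real (greedy_term \<theta> k)"
    "real (greedy_term \<theta> k) \<le> inverse (greedy_rem \<theta> k) + 1"
    by linarith+
qed

lemma greedy_rem_pos:
  assumes "0 < \<theta>"
  shows "0 < greedy_rem \<theta> k"
proof (induction k)
  case 0
  show ?case using assms by (simp add: greedy_rem_def)
next
  case (Suc k)
  have "0 < inverse (greedy_rem \<theta> k)"
    using Suc by simp
  hence "inverse (real (greedy_term \<theta> k)) < greedy_rem \<theta> k"
    using greedy_term_bounds(1)[OF Suc] Suc
    by (metis inverse_inverse_eq less_imp_inverse_less)
  thus ?case
    by (simp add: greedy_rem_Suc inverse_eq_divide)
qed

lemma greedy_term_pos:
  assumes "0 < \<theta>"
  shows "0 < greedy_term \<theta> k"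
proof -
  have "0 < inverse (greedy_rem \<theta> k)"
    using greedy_rem_pos[OF assms] by simp
  also note greedy_term_bounds(1)[OF greedy_rem_pos[OF assms]]
  finally show ?thesis by simp
qed

lemma nonincreasing_nat_eventually_const:
  fixes p :: "nat \<Rightarrow> nat"
  assumes "\<And>k. p (Suc k) \<le> p k"
  shows "\<exists>K. \<forall>k\<ge>K. p k = p K"
proof -
  obtain K where K: "\<And>k. p K \<le> p k"
    using ex_has_least_nat[of "\<lambda>_. True" undefined p] by auto
  have "p k \<le> p K" if "K \<le> k" for k
    by (rule lift_Suc_antimono_le[of p]) (use assms that in auto)
  thus ?thesis
    using K by (intro exI[of _ K]) (auto intro: antisym)
qed

text \<open>Write the remainder as \<open>p k / q k\<close>, where \<open>q k\<close> is a
  denominator of \<open>\<theta>\<close> times the product of the earlier terms, without cancelling.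
  Then \<open>p (Suc k) = p k * g k - q k\<close>, and \<open>g k \<le> q k / p k + 1\<close> gives
  \<open>p (Suc k) \<le> p k\<close>. So the numerators become constant, and
  \<open>p (Suc k) = p k\<close> says that the remainder is \<open>1 / (g k - 1)\<close>.\<close>

lemma greedy_rem_eventually:
  assumes "0 < \<theta>" "\<theta> \<in> \<rat>"
  shows "\<exists>K. \<forall>k\<ge>K. 2 \<le> greedy_term \<theta> k \<and> greedy_rem \<theta> k = 1 / (real (greedy_term \<theta> k) - 1)"
proof -
  define g where "g = greedy_term \<theta>"
  define r where "r = greedy_rem \<theta>"
  have r: "0 < r k" for k
    using greedy_rem_pos[OF assms(1)] by (simp add: r_def)
  have g: "0 < g k" for k
    using greedy_term_pos[OF assms(1)] by (simp add: g_def)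
  obtain q0 :: int where q0: "0 < q0" "\<theta> * of_int q0 \<in> \<int>"
  proof -
    obtain i q :: int where "\<theta> = of_int i / of_int q" "0 < q"
      using assms(2) by (rule Rats_cases')
    thus ?thesis using that[of q] by simp
  qed
  define q :: "nat \<Rightarrow> int" where "q k = q0 * (\<Prod>i<k. int (g i))" for k
  have q: "0 < q k" "q (Suc k) = q k * int (g k)" for k
    using q0 g by (auto simp: q_def intro!: mult_pos_pos prod_pos)
  have Ints: "r k * of_int (q k) \<in> \<int>" for k
  proof (induction k)
    case 0
    show ?case using q0 by (simp add: r_def greedy_rem_def q_def)
  next
    case (Suc k)
    have "r (Suc k) * of_int (q (Suc k)) = r k * of_int (q k) * of_int (int (g k)) - of_int (q k)"
      using g[of k] by (simp add: q r_def greedy_rem_Suc field_simps flip: g_def)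
    also have "\<dots> \<in> \<int>"
      using Suc by auto
    finally show ?case .
  qed
  \<comment> \<open>The product is a positive integer, so the floor and \<open>nat\<close> only
    change its type; in \<open>nat\<close> a nonincreasing sequence must stabilise.\<close>
  define p where "p k = nat \<lfloor>r k * of_int (q k)\<rfloor>" for k
  have p: "real (p k) = r k * of_int (q k)" for k
  proof -
    have "0 \<le> r k * of_int (q k)"
      using r[of k] q(1)[of k] by (simp add: less_imp_le)
    thus ?thesis
      using Ints[of k] by (auto simp: p_def elim!: Ints_cases)
  qed
  have p_Suc: "real (p (Suc k)) = real (p k) * real (g k) - of_int (q k)" for k
    unfolding p using g[of k] by (simp add: q r_def greedy_rem_Suc field_simps flip: g_def)
  have g_le: "real (g k) \<le> inverse (r k) + 1" for k
    using greedy_term_bounds(2) r by (simp add: g_def r_def)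
  have "p (Suc k) \<le> p k" for k
  proof -
    have "real (p k) * real (g k) \<le> real (p k) * (inverse (r k) + 1)"
      using g_le by (intro mult_left_mono) auto
    also have "\<dots> = of_int (q k) + real (p k)"
      using r[of k] by (simp add: p field_simps)
    finally show ?thesis
      using p_Suc[of k] by simp
  qed
  then obtain K where K: "\<And>k. k \<ge> K \<Longrightarrow> p k = p K"
    using nonincreasing_nat_eventually_const by blast
  have "2 \<le> g k \<and> r k = 1 / (real (g k) - 1)" if "K \<le> k" for k
  proof -
    have "p (Suc k) = p k"
      using K that by (metis le_SucI)
    hence "r k * of_int (q k) * (real (g k) - 1) = of_int (q k)"
      using p_Suc[of k] p[of k] by (simp add: algebra_simps)
    hence rg: "r k * (real (g k) - 1) = 1"
      using q(1)[of k] by simp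
    have "0 < real (g k) - 1"
      using rg r[of k] by (smt (verit) mult_nonneg_nonpos)
    thus ?thesis
      using rg by (simp add: field_simps)
  qed
  thus ?thesis
    unfolding g_def r_def by blast
qed

text \<open>For consecutive late terms \<open>x\<close> and \<open>y\<close> both remainders are
  known, so \<open>1 / (y - 1) = 1 / (x - 1) - 1 / x\<close>. The right side is the reciprocal of
  \<open>x * (x - 1)\<close>.\<close>

lemma greedy_term_eventually_sylvester:
  assumes "0 < \<theta>" "\<theta> \<in> \<rat>"
  shows "\<exists>K. \<forall>k\<ge>K. greedy_term \<theta> (Suc k) = (greedy_term \<theta> k)\<^sup>2 - greedy_term \<theta> k + 1"
proof -
  obtain K where K: "\<And>k. k \<ge> K \<Longrightarrow> 2 \<le> greedy_term \<theta> k \<and>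
      greedy_rem \<theta> k = 1 / (real (greedy_term \<theta> k) - 1)"
    using greedy_rem_eventually[OF assms] by blast
  have "greedy_term \<theta> (Suc k) = (greedy_term \<theta> k)\<^sup>2 - greedy_term \<theta> k + 1" if "K \<le> k" for k
  proof -
    define x where "x = greedy_term \<theta> k"
    define y where "y = greedy_term \<theta> (Suc k)"
    have "2 \<le> x" "2 \<le> y"
      using K[of k] K[of "Suc k"] that by (auto simp: x_def y_def)
    hence x: "2 \<le> real x" and y: "2 \<le> real y"
      by linarith+
    have "1 / (real y - 1) = 1 / (real x - 1) - 1 / real x"
      using K[of k] K[of "Suc k"] greedy_rem_Suc[of \<theta> k] that by (simp add: x_def y_def)
    also have "\<dots> = 1 / ((real x)\<^sup>2 - real x)"
      using x by (simp add: field_simps power2_eq_square)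
    finally have "real y - 1 = (real x)\<^sup>2 - real x"
      by (metis divide_divide_eq_right div_by_1 mult_1)
    \<comment> \<open>This ensures that the subtraction \<open>x\<^sup>2 - x\<close> in
      \<open>nat\<close> does not truncate.\<close>
    moreover have "x \<le> x\<^sup>2"
      by (simp add: power2_eq_square)
    ultimately have "real y = real (x\<^sup>2 - x + 1)"
      by (simp add: of_nat_diff)
    thus ?thesis
      by (simp only: of_nat_eq_iff x_def y_def)
  qed
  thus ?thesis by blast
qed

text \<open>Bounded partial sums make the series converge, so its terms tend to 0. The remainder
  eventually has the form \<open>1 / (g - 1)\<close> with \<open>g \<ge> 2\<close>, which is at most
  \<open>2 / g\<close>, and so it tends to 0 as well.\<close>

lemma greedy_term_sums:
  assumes "0 < \<theta>" "\<theta> \<in> \<rat>"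
  shows "(\<lambda>i. 1 / real (greedy_term \<theta> i)) sums \<theta>"
proof -
  have pos: "0 \<le> 1 / real (greedy_term \<theta> i)" for i
    by simp
  have le: "(\<Sum>i<k. 1 / real (greedy_term \<theta> i)) \<le> \<theta>" for k
    using greedy_rem_pos[OF assms(1), of k] by (simp add: greedy_rem_def recip_sum_greedy_under)
  have "summable (\<lambda>i. 1 / real (greedy_term \<theta> i))"
    by (rule bounded_imp_summable[of _ \<theta>, OF pos]) (metis le lessThan_Suc_atMost)
  hence lim: "(\<lambda>i. 1 / real (greedy_term \<theta> i)) \<longlonglongrightarrow> 0"
    by (rule summable_LIMSEQ_zero)
  obtain K where K: "\<And>k. k \<ge> K \<Longrightarrow> 2 \<le> greedy_term \<theta> k \<and>
      greedy_rem \<theta> k = 1 / (real (greedy_term \<theta> k) - 1)"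
    using greedy_rem_eventually[OF assms] by blast
  have upper: "greedy_rem \<theta> k \<le> 2 * (1 / real (greedy_term \<theta> k))" if "K \<le> k" for k
  proof -
    have "2 \<le> real (greedy_term \<theta> k)"
      using K[OF that] by linarith
    thus ?thesis
      using K[OF that] by (simp add: field_simps)
  qed
  have "greedy_rem \<theta> \<longlonglongrightarrow> 0"
  proof (rule tendsto_sandwich[of "\<lambda>_. 0"])
    show "\<forall>\<^sub>F k in sequentially. greedy_rem \<theta> k \<le> 2 * (1 / real (greedy_term \<theta> k))"
      using upper by (auto simp: eventually_sequentially)
    show "(\<lambda>k. 2 * (1 / real (greedy_term \<theta> k))) \<longlonglongrightarrow> 0"
      using tendsto_mult_right_zero[OF lim] by simp
  qed (use greedy_rem_pos[OF assms(1)] in \<open>auto intro!: always_eventually less_imp_le\<close>)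
  hence "(\<lambda>k. \<theta> - greedy_rem \<theta> k) \<longlonglongrightarrow> \<theta> - 0"
    by (intro tendsto_intros)
  thus ?thesis
    by (simp add: sums_def greedy_rem_def recip_sum_greedy_under)
qed

section \<open>Doubly exponential growth\<close>

text \<open>The recurrence gives \<open>c (n + 1) \<le> (c n)\<^sup>2\<close> for late
  \<open>n\<close>, so the roots eventually decrease weakly, and they are bounded below by
  0.\<close>

lemma eventually_sylvester_imp_convergent_root:
  assumes "eventually_sylvester c"
  shows "convergent (\<lambda>n. real (c n) powr (1 / 2 ^ n))"
proof -
  obtain N where N: "\<And>n. n \<ge> N \<Longrightarrow> c (n + 1) = (c n)\<^sup>2 - c n + 1"
    using assms by (auto simp: eventually_sylvester_def)
  define f where "f n = real (c n) powr (1 / 2 ^ n)" for n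
  have step: "f (Suc n) \<le> f n" if "Suc N \<le> n" for n
  proof -
    \<comment> \<open>A term produced by the recurrence is at least 1 whatever its predecessor.
      Hence the start at \<open>Suc N\<close>: the value at \<open>N\<close> itself might be
      0.\<close>
    have "0 < c n"
      using N[of "n - 1"] that by simp
    hence "c n \<le> (c n)\<^sup>2" "0 < (c n)\<^sup>2"
      by (simp_all add: power2_eq_square)
    hence "c (Suc n) \<le> (c n)\<^sup>2"
      using N[of n] that \<open>0 < c n\<close> by auto
    hence "f (Suc n) \<le> real ((c n)\<^sup>2) powr (1 / 2 ^ Suc n)"
      unfolding f_def by (intro powr_mono2) (auto simp del: of_nat_power)
    also have "\<dots> = (real (c n) powr 2) powr (1 / 2 ^ Suc n)"
      using \<open>0 < c n\<close> by simp
    also have "\<dots> = f n"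
      by (simp add: powr_powr f_def del: powr_numeral)
    finally show ?thesis .
  qed
  have "decseq (\<lambda>n. f (n + Suc N))"
    by (rule decseq_SucI) (use step in auto)
  then obtain L where "(\<lambda>n. f (n + Suc N)) \<longlonglongrightarrow> L"
    using decseq_convergent[of "\<lambda>n. f (n + Suc N)" 0] by (force simp: f_def)
  hence "f \<longlonglongrightarrow> L"
    by (rule LIMSEQ_offset)
  thus ?thesis
    by (auto simp: convergent_def f_def[abs_def])
qed

text \<open>The bound telescopes: for \<open>x = M ^ 2 ^ (k + 1)\<close>, the term
  \<open>1 / x\<close> is at most \<open>1 / (x - 1) - 1 / (x\<^sup>2 - 1)\<close>, and
  \<open>x\<^sup>2\<close> belongs to the next index. So the tail \<open>A\<close> minus the bound
  \<open>B\<close> never decreases from \<open>n\<close> on. It stays below \<open>A\<close>, which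
  tends to 0, hence \<open>A n - B n \<le> 0\<close>.\<close>

lemma tail_le_of_doubly_exponential:
  fixes a :: "nat \<Rightarrow> nat"
  assumes a_sum: "(\<lambda>i. 1 / real (a (i + 1))) sums s" and M: "1 < M"
    and a: "\<And>n. N \<le> n \<Longrightarrow> M ^ 2 ^ n \<le> real (a n)" and "N \<le> n"
  shows "s - (\<Sum>i<n. 1 / real (a (i + 1))) \<le> 1 / (M ^ 2 ^ (n + 1) - 1)"
proof -
  define b where "b n = M ^ 2 ^ n" for n :: nat
  define A where "A n = s - (\<Sum>i<n. 1 / real (a (i + 1)))" for n
  define B where "B n = 1 / (b (n + 1) - 1)" for n
  have b: "1 < b n" for n
    using M by (simp add: b_def one_less_power)
  have step: "A k - B k \<le> A (Suc k) - B (Suc k)" if "n \<le> k" for k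
  proof -
    define x where "x = b (k + 1)"
    have "1 < x"
      using b by (simp add: x_def)
    hence "1 < x * x"
      by (simp add: less_1_mult)
    have "1 / real (a (k + 1)) \<le> 1 / x"
      using a[of "k + 1"] that \<open>N \<le> n\<close> \<open>1 < x\<close> by (intro divide_left_mono) (auto simp: x_def b_def)
    also have "\<dots> \<le> x / (x * x - 1)"
      using \<open>1 < x\<close> \<open>1 < x * x\<close> by (simp add: divide_simps)
    also have "\<dots> = 1 / (x - 1) - 1 / (x * x - 1)"
      using \<open>1 < x\<close> \<open>1 < x * x\<close> by (simp add: divide_simps) (simp add: algebra_simps)
    also have "x * x = b (Suc k + 1)"
      by (simp add: x_def b_def power_add flip: power_mult power2_eq_square)
    finally show ?thesis
      by (simp add: A_def B_def x_def)
  qed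
  have mono: "A n - B n \<le> A k - B k" if "n \<le> k" for k
    using that
  proof (induction k rule: dec_induct)
    case (step k)
    then show ?case
      using \<open>\<And>k. n \<le> k \<Longrightarrow> A k - B k \<le> A (Suc k) - B (Suc k)\<close>[of k] by linarith
  qed simp
  have "A k - B k \<le> A k" for k
    using b[of "k + 1"] by (simp add: B_def)
  hence "\<forall>k\<ge>n. A n - B n \<le> A k"
    using mono by (meson order_trans)
  moreover have "A \<longlonglongrightarrow> 0"
  proof -
    have "(\<lambda>n. s - (\<Sum>i<n. 1 / real (a (i + 1)))) \<longlonglongrightarrow> s - s"
      by (intro tendsto_intros) (use a_sum in \<open>simp add: sums_def\<close>)
    thus ?thesis by (simp add: A_def[abs_def])
  qed
  ultimately have "A n - B n \<le> 0"
    by (intro LIMSEQ_le_const) auto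
  thus ?thesis
    by (simp add: A_def B_def b_def)
qed

lemma liminf_growth_le:
  fixes a c :: "nat \<Rightarrow> nat"
  assumes a_sum: "(\<lambda>i. 1 / real (a (i + 1))) sums s"
    and lim: "(\<lambda>n. real (c n) powr (1 / 2 ^ n)) \<longlonglongrightarrow> L"
    and c: "\<And>n. K \<le> n \<Longrightarrow> 2 \<le> c (n + 1) \<and>
      1 / (real (c (n + 1)) - 1) \<le> s - (\<Sum>i<n. 1 / real (a (i + 1)))"
  shows "liminf (\<lambda>n. ereal (real (a n) powr (1 / 2 ^ n))) \<le> ereal L"
proof (rule ccontr)
  assume "\<not> ?thesis"
  hence "ereal L < liminf (\<lambda>n. ereal (real (a n) powr (1 / 2 ^ n)))"
    by simp
  \<comment> \<open>The liminf may be infinite, but a real \<open>M\<close> still fits strictly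
    between.\<close>
  then obtain M where M: "L < M" "ereal M < liminf (\<lambda>n. ereal (real (a n) powr (1 / 2 ^ n)))"
    using ereal_dense2 less_ereal.simps(1) by blast
  \<comment> \<open>The lower bound 2 on late terms of \<open>c\<close> gives
    \<open>1 \<le> L < M\<close>; the tail bound demands \<open>1 < M\<close>.\<close>
  have "1 \<le> real (c n) powr (1 / 2 ^ n)" if "Suc K \<le> n" for n
  proof -
    have "1 \<le> real (c n)"
      using c[of "n - 1"] that by (cases n) auto
    thus ?thesis
      by (intro ge_one_powr_ge_zero) auto
  qed
  hence "1 \<le> L"
    by (intro LIMSEQ_le_const[OF lim]) auto
  hence "1 < M"
    using M by simp
  have powr_root: "(M ^ 2 ^ n) powr (1 / 2 ^ n) = M" for n
    using \<open>1 < M\<close> by (simp add: powr_powr flip: powr_realpow)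
  have "\<forall>\<^sub>F n in sequentially. ereal M < ereal (real (a n) powr (1 / 2 ^ n))"
    using M(2) by (rule less_LiminfD)
  then obtain N where N: "\<And>n. N \<le> n \<Longrightarrow> M < real (a n) powr (1 / 2 ^ n)"
    by (auto simp: eventually_sequentially)
  have a: "M ^ 2 ^ n \<le> real (a n)" if "N \<le> n" for n
  proof (rule ccontr)
    assume "\<not> ?thesis"
    hence "real (a n) powr (1 / 2 ^ n) \<le> (M ^ 2 ^ n) powr (1 / 2 ^ n)"
      by (intro powr_mono2) auto
    thus False
      using N[OF that] by (simp add: powr_root)
  qed
  \<comment> \<open>The tail of \<open>a\<close> starting at \<open>a n\<close> is at least
    \<open>1 / (c n - 1)\<close> and at most \<open>1 / (M ^ 2 ^ n - 1)\<close>, so \<open>c\<close>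
    inherits the growth.\<close>
  have "M \<le> real (c n) powr (1 / 2 ^ n)" if n: "Suc (max N K) \<le> n" for n
  proof -
    obtain k where k: "n = k + 1" "N \<le> k" "K \<le> k"
      using n by (cases n) auto
    have "1 / (real (c n) - 1) \<le> 1 / (M ^ 2 ^ n - 1)"
      using tail_le_of_doubly_exponential[OF a_sum \<open>1 < M\<close> a k(2)] c[OF k(3)] k(1) by force
    moreover have "1 < M ^ 2 ^ n"
      using \<open>1 < M\<close> by (simp add: one_less_power)
    moreover have "1 < real (c n)"
      using c[OF k(3)] k(1) by simp
    ultimately have "M ^ 2 ^ n \<le> real (c n)"
      by (simp add: divide_simps)
    hence "(M ^ 2 ^ n) powr (1 / 2 ^ n) \<le> real (c n) powr (1 / 2 ^ n)"
      using \<open>1 < M\<close> by (intro powr_mono2) auto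
    thus ?thesis
      by (simp add: powr_root)
  qed
  hence "M \<le> L"
    by (intro LIMSEQ_le_const[OF lim]) blast
  thus False
    using M by simp
qed

section \<open>Construction of the competing Sylvester sequence\<close>

text \<open>Sequences are indexed from 1, but \<open>g\<close> from 0.\<close>

definition prepend :: "nat list \<Rightarrow> (nat \<Rightarrow> nat) \<Rightarrow> nat \<Rightarrow> nat" where
  "prepend ys g n = (if n \<le> length ys then ys ! (n - 1) else g (n - length ys - 1))"

lemma prepend_past [simp]: "prepend ys g (Suc (length ys + k)) = g k"
  by (simp add: prepend_def)

lemma sum_prepend:
  "(\<Sum>i<length ys + k. 1 / real (prepend ys g (i + 1))) = recip_sum ys + (\<Sum>i<k. 1 / real (g i))"
proof (induction k)
  case 0
  show ?case
    by (simp add: recip_sum_def prepend_def sum_list_sum_nth atLeast0LessThan)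
qed simp

lemma prepend_sums:
  assumes "(\<lambda>i. 1 / real (g i)) sums s"
  shows "(\<lambda>i. 1 / real (prepend ys g (i + 1))) sums (recip_sum ys + s)"
proof -
  have "(\<lambda>k. recip_sum ys + (\<Sum>i<k. 1 / real (g i))) \<longlonglongrightarrow> recip_sum ys + s"
    using assms by (intro tendsto_intros) (simp add: sums_def)
  hence "(\<lambda>k. \<Sum>i<k + length ys. 1 / real (prepend ys g (i + 1))) \<longlonglongrightarrow> recip_sum ys + s"
    by (simp only: sum_prepend add.commute[of _ "length ys"])
  thus ?thesis
    unfolding sums_def by (rule LIMSEQ_offset)
qed

text \<open>The clause \<open>c m = a m\<close> serves to separate \<open>c\<close> from
  \<open>u\<close> as sets, the last one to compare growth. After \<open>a 1, ..., a m\<close> come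
  a best \<open>n0\<close>-term list \<open>xs\<close> for the rest \<open>\<theta>\<close> and the
  greedy expansion of what then remains. By the hypothesis these attain
  \<open>R (n0 + k) \<theta>\<close> for \<open>k \<ge> 1\<close>, so the next \<open>n0 + k\<close>
  terms of \<open>a\<close> cannot do better.\<close>

lemma sylvester_competitor:
  fixes a :: "nat \<Rightarrow> nat"
  assumes hyp: "\<forall>\<theta>::real. \<theta> \<in> \<rat> \<and> 0 < \<theta> \<and> \<theta> \<le> 1 \<longrightarrow> eventually_greedy_best \<theta>"
    and s: "s \<in> \<rat>" "s \<le> 1"
    and a_pos: "\<forall>n\<ge>1. 0 < a n"
    and a_sum: "(\<lambda>i. 1 / real (a (i + 1))) sums s"
    and "1 \<le> m"
  shows "\<exists>c K. (\<forall>n\<ge>1. 0 < c n) \<and> eventually_sylvester c \<and>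
    (\<lambda>i. 1 / real (c (i + 1))) sums s \<and> c m = a m \<and>
    (\<forall>n\<ge>K. 2 \<le> c (n + 1) \<and>
      1 / (real (c (n + 1)) - 1) \<le> s - (\<Sum>i<n. 1 / real (a (i + 1))))"
proof -
  define as where "as = map a [1..<Suc m]"
  define \<theta> where "\<theta> = s - recip_sum as"
  have recip_as: "recip_sum as = (\<Sum>i<m. 1 / real (a (i + 1)))"
    unfolding as_def by (rule recip_sum_map)
  have "0 < \<theta>"
    using partial_sum_less_of_sums[OF a_pos a_sum, of m] by (simp add: \<theta>_def recip_as)
  moreover have "\<theta> \<le> 1"
    using s recip_sum_nonneg[of as] by (simp add: \<theta>_def)
  moreover have "\<theta> \<in> \<rat>"
    using s recip_sum_Rats by (simp add: \<theta>_def)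
  ultimately obtain n0 where n0: "\<And>n. n0 + 1 \<le> n \<Longrightarrow>
      R n \<theta> = R n0 \<theta> + R (n - n0) (\<theta> - R n0 \<theta>) \<and>
      best_under (\<theta> - R n0 \<theta>) (n - n0) (greedy_under (\<theta> - R n0 \<theta>) (n - n0))"
    using hyp unfolding eventually_greedy_best_def by blast
  obtain xs where xs: "best_under \<theta> n0 xs"
    using best_under_exists[OF \<open>0 < \<theta>\<close>] by blast
  define \<theta>' where "\<theta>' = \<theta> - R n0 \<theta>"
  have \<theta>': "\<theta>' = \<theta> - recip_sum xs" "0 < \<theta>'"
    using R_eq[OF xs] xs by (auto simp: \<theta>'_def best_under_def egyptian_under_def)
  have "\<theta>' \<in> \<rat>"
    using \<open>\<theta> \<in> \<rat>\<close> recip_sum_Rats by (simp add: \<theta>')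
  define g where "g = greedy_term \<theta>'"
  have g_pos: "0 < g k" for k
    using greedy_term_pos \<theta>' by (simp add: g_def)
  obtain K where K: "\<And>k. k \<ge> K \<Longrightarrow> 2 \<le> g k \<and> greedy_rem \<theta>' k = 1 / (real (g k) - 1)"
    using greedy_rem_eventually[OF \<theta>'(2) \<open>\<theta>' \<in> \<rat>\<close>] unfolding g_def by blast
  obtain K' where K': "\<And>k. k \<ge> K' \<Longrightarrow> g (Suc k) = (g k)\<^sup>2 - g k + 1"
    using greedy_term_eventually_sylvester[OF \<theta>'(2) \<open>\<theta>' \<in> \<rat>\<close>] unfolding g_def by blast
  define ys where "ys = as @ xs"
  define c where "c = prepend ys g"
  have len: "length as = m" "length xs = n0" "length ys = m + n0"
    using xs by (auto simp: as_def ys_def best_under_def egyptian_under_def)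
  have ys_pos: "\<forall>y\<in>set ys. 0 < y"
    using a_pos xs by (auto simp: as_def ys_def best_under_def egyptian_under_def)
  have c_past: "c (Suc (m + n0 + k)) = g k" for k
    using prepend_past[of ys g k] by (simp add: c_def len)

  have "\<forall>n\<ge>1. 0 < c n"
    using ys_pos g_pos by (auto simp: c_def prepend_def)
  moreover have "eventually_sylvester c"
    unfolding eventually_sylvester_def
  proof (intro exI[of _ "Suc (m + n0 + K')"] conjI allI impI)
    fix n assume "Suc (m + n0 + K') \<le> n"
    then obtain d where "n = Suc (m + n0 + K') + d"
      using le_Suc_ex by blast
    then obtain k where "n = Suc (m + n0 + k)" "K' \<le> k"
      by (intro that[of "K' + d"]) auto
    thus "c (n + 1) = (c n)\<^sup>2 - c n + 1"
      using K'[of k] c_past[of k] c_past[of "Suc k"] by simp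
  qed simp
  moreover have "(\<lambda>i. 1 / real (c (i + 1))) sums s"
  proof -
    have "recip_sum ys + \<theta>' = s"
      by (simp add: ys_def \<theta>' \<theta>_def)
    thus ?thesis
      using prepend_sums[OF greedy_term_sums[OF \<theta>'(2) \<open>\<theta>' \<in> \<rat>\<close>], of ys]
      by (simp add: c_def g_def)
  qed
  moreover have "c m = a m"
    using \<open>1 \<le> m\<close> len by (simp add: c_def prepend_def ys_def nth_append as_def)
  \<comment> \<open>\<open>Suc K\<close> instead of \<open>K\<close> ensures
    \<open>k \<ge> 1\<close>, since the hypothesis concerns lengths from \<open>n0 + 1\<close>
    on.\<close>
  moreover have "2 \<le> c (n + 1) \<and>
      1 / (real (c (n + 1)) - 1) \<le> s - (\<Sum>i<n. 1 / real (a (i + 1)))"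
    if "m + n0 + Suc K \<le> n" for n
  proof -
    define k where "k = n - m - n0"
    have k: "n = m + (n0 + k)" "K \<le> k" "1 \<le> k"
      using that by (auto simp: k_def)
    \<comment> \<open>The \<open>n0 + k\<close> terms of \<open>a\<close> after the first
      \<open>m\<close>, as a competitor for \<open>\<theta>\<close>.\<close>
    define zs where "zs = map (\<lambda>i. a (m + i)) [1..<Suc (n0 + k)]"
    have "recip_sum as + recip_sum zs = (\<Sum>i<m + (n0 + k). 1 / real (a (i + 1)))"
      unfolding recip_as zs_def recip_sum_map by (simp add: sum_lessThan_add)
    hence recip_split: "recip_sum as + recip_sum zs = (\<Sum>i<n. 1 / real (a (i + 1)))"
      by (simp only: k(1))
    have "R (n0 + k) \<theta> = recip_sum xs + recip_sum (greedy_under \<theta>' k)"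
      using n0[of "n0 + k"] k(3) R_eq[OF xs] R_eq[of \<theta>' k "greedy_under \<theta>' k"]
      by (simp add: \<theta>'_def)
    moreover have "recip_sum zs \<le> R (n0 + k) \<theta>"
    proof -
      obtain ws where ws: "best_under \<theta> (n0 + k) ws"
        using best_under_exists[OF \<open>0 < \<theta>\<close>] by blast
      have "recip_sum zs < \<theta>"
        using recip_split partial_sum_less_of_sums[OF a_pos a_sum, of n] by (simp add: \<theta>_def)
      thus ?thesis
        using best_under_ge[OF ws, of zs] a_pos by (auto simp: R_eq[OF ws] zs_def)
    qed
    \<comment> \<open>The left side equals \<open>1 / (g k - 1)\<close>, and \<open>g k\<close> is
      the term \<open>c (n + 1)\<close>.\<close>
    ultimately have "greedy_rem \<theta>' k \<le> s - (\<Sum>i<n. 1 / real (a (i + 1)))"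
      using recip_split by (simp add: greedy_rem_def \<theta>' \<theta>_def)
    thus ?thesis
      using K[OF k(2)] c_past[of k] k(1) by (simp add: add.assoc)
  qed
  ultimately show ?thesis by blast
qed

theorem theorem1p12:
  fixes lam :: real and u a :: "nat \<Rightarrow> nat"
  assumes hyp: "\<forall>\<theta>::real. \<theta> \<in> \<rat> \<and> 0 < \<theta> \<and> \<theta> \<le> 1 \<longrightarrow> eventually_greedy_best \<theta>"
    and lam: "lam \<in> \<rat>" "0 < lam" "lam \<le> 1"
    and unique: "\<forall>m\<ge>1. \<exists>!xs. best_under lam m xs"
    and u: "best_seq lam u"
    and a_pos: "\<forall>n\<ge>1. 0 < a n"
    and a_strict: "strict_mono_on {1..} a"
    and a_sum: "(\<lambda>i. 1 / real (a (i + 1))) sums lam"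
    and a_other: "\<exists>n\<ge>1. a n \<noteq> u n"
  shows "\<exists>c :: nat \<Rightarrow> nat.
           (\<forall>n\<ge>1. 0 < c n) \<and>
           eventually_sylvester c \<and>
           (\<lambda>i. 1 / real (c (i + 1))) sums lam \<and>
           c ` {1..} \<noteq> u ` {1..} \<and>
           (\<exists>L::real. (\<lambda>n. real (c n) powr (1 / 2 ^ n)) \<longlonglongrightarrow> L \<and>
              liminf (\<lambda>n. ereal (real (a n) powr (1 / 2 ^ n))) \<le> ereal L)"
proof -
  have u_sum: "(\<Sum>i<n. 1 / real (u (i + 1))) \<le> lam" for n
  \<comment> \<open>\<open>best_seq\<close> says nothing about length 0.\<close>
  proof (cases "n = 0")
    case False
    hence "best_under lam n (map u [1..<Suc n])"
      using u by (simp add: best_seq_def)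
    hence "recip_sum (map u [1..<Suc n]) < lam"
      unfolding best_under_def egyptian_under_def by blast
    thus ?thesis
      unfolding recip_sum_map by simp
  qed (use lam in simp)
  have u_strict: "strict_mono_on {1..} u"
    using best_seq_strict_mono_on[OF lam(3) unique u] .
  have u_pos: "\<forall>n\<ge>1. 0 < u n"
    using best_seq_pos[OF u] by blast
  \<comment> \<open>Otherwise \<open>a\<close> and \<open>u\<close> would agree at every index from
    1 on.\<close>
  have "\<not> a ` {1..} \<subseteq> u ` {1..}"
    using seq_eq_of_sums_of_range_subset[OF a_strict u_strict _ u_pos a_sum u_sum] a_other by blast
  then obtain m where m: "1 \<le> m" "a m \<notin> u ` {1..}"
    by auto
  obtain c K where c: "\<forall>n\<ge>1. 0 < c n" "eventually_sylvester c"
    "(\<lambda>i. 1 / real (c (i + 1))) sums lam" "c m = a m"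
    "\<And>n. K \<le> n \<Longrightarrow> 2 \<le> c (n + 1) \<and>
      1 / (real (c (n + 1)) - 1) \<le> lam - (\<Sum>i<n. 1 / real (a (i + 1)))"
    using sylvester_competitor[OF hyp lam(1,3) a_pos a_sum m(1)] by blast
  obtain L where L: "(\<lambda>n. real (c n) powr (1 / 2 ^ n)) \<longlonglongrightarrow> L"
    using eventually_sylvester_imp_convergent_root[OF c(2)] by (auto simp: convergent_def)
  have "c m \<in> c ` {1..}"
    using m(1) by simp
  hence "c ` {1..} \<noteq> u ` {1..}"
    using m(2) c(4) by metis
  moreover have "liminf (\<lambda>n. ereal (real (a n) powr (1 / 2 ^ n))) \<le> ereal L"
    using a_sum L c(5) by (rule liminf_growth_le)
  ultimately show ?thesis
    using c(1-3) L by (intro exI[of _ c] exI[of _ L] conjI)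
qed

end
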